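(* For every positive integer $n$, let $q_n$ denote the smallest prime number which does not divide $n$. Let $$\ell_2 := \sum_{n \in \mathbb{N}}\frac{1}{\prod_{p \text{ prime},\, p \leq n} p}.$$ Then $\ell_2 < + \infty$ and, as $N \to +\infty$, $$\frac{1}{N} \sum_{n = 1}^{N} q_n = \ell_2 + O\left(\frac{(\log N)^2}{N \log\log N}\right).$$
   Context: $\mathbb{N} = \{0, 1, 2, \dots\}$ includes $0$. The empty product is equal to $1$, so the $n=0$ and $n=1$ terms of the series are both $1$. $\log$ is the natural logarithm. *)

theory Defs
  imports Complex_Main "HOL-Computational_Algebra.Primes" "HOL-Library.Landau_Symbols"
begin

text \<open>Only meaningful for \<open>n > 0\<close>: every prime divides 0.\<close>

definition least_nondiv_prime :: "nat \<Rightarrow> nat" where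
  "least_nondiv_prime n = (LEAST p. prime p \<and> \<not> p dvd n)"

definition primorial :: "nat \<Rightarrow> nat" where
  "primorial n = \<Prod>{p. prime p \<and> p \<le> n}"

definition ell2 :: real where
  "ell2 = (\<Sum>n. 1 / real (primorial n))"

end

theory Submission
  imports Defs "HOL-Computational_Algebra.Squarefree" "HOL-Library.Discrete_Functions" "HOL-Real_Asymp.Real_Asymp"
begin

text \<open>
  Write \<open>P m\<close> for the primorial of \<open>m\<close>. For \<open>n > 0\<close>, the least prime not dividing \<open>n\<close> exceeds \<open>m\<close>
  iff every prime up to \<open>m\<close> divides \<open>n\<close>, that is, iff \<open>P m\<close> divides \<open>n\<close>. So this prime is the
  number of \<open>m \<ge> 0\<close> with \<open>P m dvd n\<close>, and exchanging the two summations gives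
  \<open>(\<Sum>n=1..N. q n) = (\<Sum>m. N div P m)\<close> (lemma \<open>sums_div_primorial\<close>). The difference from
  \<open>N * ell2 = (\<Sum>m. N / P m)\<close> is a sum of fractional parts, each of them at most
  \<open>min 1 (N / P m)\<close>.

  Hence everything rests on the growth of \<open>P m\<close>. If \<open>P m\<close> is eventually at least \<open>sqrt 2 ^ m\<close>,
  the series converges; moreover, bounding the first \<open>L = O(ln N)\<close> fractional parts by \<open>1\<close> and
  the others by a geometric series whose first term is at most \<open>1\<close>, the total error is
  \<open>O(ln N)\<close>. Dividing by \<open>N\<close> gives the error term \<open>O(ln N / N)\<close>, which is smaller than the
  one claimed by a factor \<open>ln N / ln (ln N)\<close>.

  The growth of \<open>P m\<close> is a Chebyshev-type bound with a short proof. A common multiple \<open>D\<close> of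
  \<open>1, \<dots>, N\<close> is at least \<open>2 ^ (N - 1)\<close>, because \<open>D\<close> times any of the first \<open>N\<close> rows of
  the Leibniz harmonic triangle is integral (lemma \<open>common_multiple_ge\<close>). Writing \<open>j \<le> N\<close> as
  \<open>s * t\<^sup>2\<close> with \<open>s\<close> squarefree shows that \<open>P N * (fact r)\<^sup>2\<close> is such a common multiple, where \<open>r\<close> is the
  integer part of \<open>sqrt N\<close>; and the second factor is at most \<open>N powr sqrt N\<close>, which is
  subexponential.
\<close>

section \<open>Summing least non-dividing primes\<close>

lemma primorial_pos: "primorial n > 0"
  unfolding primorial_def by (intro prod_pos) (auto intro: prime_gt_0_nat)

lemma primorial_dvd_iff: "primorial m dvd n \<longleftrightarrow> (\<forall>p. prime p \<and> p \<le> m \<longrightarrow> p dvd n)"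
proof
  assume "primorial m dvd n"
  moreover have "p dvd primorial m" if "prime p" "p \<le> m" for p
    unfolding primorial_def using that by (intro dvd_prodI[of _ _ "\<lambda>p. p", simplified]) auto
  ultimately show "\<forall>p. prime p \<and> p \<le> m \<longrightarrow> p dvd n"
    by (blast intro: dvd_trans)
next
  assume *: "\<forall>p. prime p \<and> p \<le> m \<longrightarrow> p dvd n"
  have "\<Prod>A dvd n" if "finite A" "\<forall>p\<in>A. prime p \<and> p dvd n" for A
    using that
  proof (induction A rule: finite_induct)
    case (insert p A)
    have "coprime p (\<Prod>A)"
      using insert by (intro prod_coprime_right) (auto intro: primes_coprime)
    then show ?case
      using insert by (auto intro: divides_mult)
  qed auto
  moreover have "finite {p. prime p \<and> p \<le> m}"
    by (rule finite_subset[of _ "{..m}"]) auto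
  ultimately show "primorial m dvd n"
    unfolding primorial_def using * by blast
qed

lemma primorial_dvd_iff_less_least_nondiv_prime:
  assumes "n > 0"
  shows "primorial m dvd n \<longleftrightarrow> m < least_nondiv_prime n"
proof -
  obtain p where "prime p" "p > n"
    using bigger_prime by blast
  hence "prime p \<and> \<not> p dvd n"
    using assms by (auto dest: dvd_imp_le)
  hence "prime (least_nondiv_prime n) \<and> \<not> least_nondiv_prime n dvd n"
    unfolding least_nondiv_prime_def by (rule LeastI)
  moreover have "least_nondiv_prime n \<le> p" if "prime p \<and> \<not> p dvd n" for p
    unfolding least_nondiv_prime_def using that by (rule Least_le)
  ultimately show ?thesis
    unfolding primorial_dvd_iff by (meson dual_order.strict_trans1 leD leI)
qed

lemma card_multiples:
  assumes "d > 0"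
  shows "card {n\<in>{1..N}. d dvd n} = N div d"
proof -
  have "{n\<in>{1..N}. d dvd n} = (\<lambda>k. d * k) ` {1..N div d}"
  proof (intro equalityI subsetI)
    fix n assume "n \<in> {n\<in>{1..N}. d dvd n}"
    then obtain k where "n = d * k" "1 \<le> d * k" "d * k \<le> N" by (auto elim: dvdE)
    moreover from this have "k \<noteq> 0" by (intro notI) simp
    ultimately show "n \<in> (\<lambda>k. d * k) ` {1..N div d}"
      using assms by (simp add: less_eq_div_iff_mult_less_eq mult.commute)
  next
    fix n assume "n \<in> (\<lambda>k. d * k) ` {1..N div d}"
    then obtain k where "n = d * k" "1 \<le> k" "k \<le> N div d" by (metis atLeastAtMost_iff imageE)
    thus "n \<in> {n\<in>{1..N}. d dvd n}"
      using assms by (simp add: less_eq_div_iff_mult_less_eq mult.commute)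
  qed
  moreover have "inj_on (\<lambda>k. d * k) {1..N div d}"
    using assms by (auto intro: inj_onI)
  ultimately show ?thesis
    by (simp add: card_image)
qed

lemma sums_div_primorial:
  "(\<lambda>m. real (N div primorial m)) sums (\<Sum>n = 1..N. real (least_nondiv_prime n))"
proof -
  have "(\<lambda>m. of_bool (primorial m dvd n) :: real) sums real (least_nondiv_prime n)"
    if "n \<in> {1..N}" for n
    using sums_finite[of "{..<least_nondiv_prime n}" "\<lambda>m. of_bool (primorial m dvd n) :: real"] that
    by (simp add: primorial_dvd_iff_less_least_nondiv_prime Int_absorb2 lessThan_def)
  hence "(\<lambda>m. \<Sum>n=1..N. of_bool (primorial m dvd n) :: real)
           sums (\<Sum>n=1..N. real (least_nondiv_prime n))"
    by (rule sums_sum)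
  moreover have "(\<Sum>n=1..N. of_bool (primorial m dvd n) :: real) = real (N div primorial m)" for m
    using card_multiples[OF primorial_pos, of N m] by (simp add: Int_def conj_commute)
  ultimately show ?thesis by simp
qed

section \<open>Exponential growth of the primorial\<close>

text \<open>
  The numbers \<open>1 / ((n + 1) * (n choose k))\<close> form the Leibniz harmonic triangle: the entries
  with \<open>k = 0\<close> are the unit fractions \<open>1 / (n + 1)\<close>, and each entry with \<open>k > 0\<close> is the
  difference of two entries with index \<open>k - 1\<close>, one in the row above and one in the same row.
  So a number which clears the unit fractions clears the whole triangle.
\<close>
lemma leibniz_triangle_Ints:
  fixes D :: nat
  assumes D: "\<And>j. 1 \<le> j \<Longrightarrow> j \<le> N \<Longrightarrow> j dvd D"
    and "n < N" "k \<le> n"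
  shows "real D / (real (Suc n) * real (n choose k)) \<in> \<int>"
  using assms(2,3)
proof (induction k arbitrary: n)
  case 0
  then obtain c where "D = Suc n * c"
    using D[of "Suc n"] by (auto elim: dvdE)
  then have "real D / (real (Suc n) * real (n choose 0)) = real c"
    by (simp del: of_nat_Suc mult_Suc)
  then show ?case by (simp only: Ints_of_nat)
next
  case (Suc k)
  then obtain m where n: "n = Suc m" and km: "k \<le> m"
    by (cases n) auto
  define C where "C = real (m choose k)"
  have C: "C > 0" using km by (simp add: C_def)
  have "Suc k * (Suc m choose Suc k) = Suc m * (m choose k)"
    by (rule Suc_times_binomial)
  hence "real (Suc k) * real (Suc m choose Suc k) = real (Suc m) * C"
    unfolding C_def of_nat_mult[symmetric] by (rule arg_cong)
  hence 1: "real (Suc m choose Suc k) = real (Suc m) * C / real (Suc k)"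
    by (simp add: field_simps del: of_nat_Suc)
  have "(Suc m - k) * (Suc m choose k) = Suc m * (m choose k)"
    using km binomial_absorb_comp[of "Suc m" k] by simp
  hence "real (Suc m - k) * real (Suc m choose k) = real (Suc m) * C"
    unfolding C_def of_nat_mult[symmetric] by (rule arg_cong)
  hence 2: "real (Suc m choose k) = real (Suc m) * C / (real m + 1 - real k)"
    using km by (simp add: field_simps of_nat_diff)
  have "real D / (real (Suc n) * real (n choose Suc k)) =
        real D / (real (Suc m) * C) - real D / (real (Suc n) * real (n choose k))"
    unfolding n 1 2 using C km by (simp add: divide_simps) (simp add: algebra_simps)
  also have "\<dots> \<in> \<int>"
    using Suc.IH[of m] Suc.IH[of n] Suc.prems n km by (intro Ints_diff) (auto simp: C_def)
  finally show ?case .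
qed

text \<open>
  Integrality of a positive multiple of a triangle entry forces \<open>(n + 1) * (n choose k) \<le> D\<close>
  for \<open>n = N - 1\<close>; the binomial coefficients in that row add up to \<open>2 ^ n\<close>.
\<close>
lemma common_multiple_ge:
  fixes D :: nat
  assumes D: "\<And>j. 1 \<le> j \<Longrightarrow> j \<le> N \<Longrightarrow> j dvd D" and "D > 0" "N > 0"
  shows "2 ^ (N - 1) \<le> D"
proof -
  obtain n where N: "N = Suc n" using \<open>N > 0\<close> by (cases N) auto
  have le: "Suc n * (n choose k) \<le> D" if "k \<le> n" for k
  proof -
    have "real D / (real (Suc n) * real (n choose k)) \<in> \<int>"
      using D that N by (intro leibniz_triangle_Ints[of N]) auto
    moreover have "real D / (real (Suc n) * real (n choose k)) > 0"
      using that \<open>D > 0\<close> by simp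
    ultimately have "real D / (real (Suc n) * real (n choose k)) \<ge> 1"
      by (auto elim!: Ints_cases simp del: of_nat_Suc) 
    hence "real (Suc n * (n choose k)) \<le> real D"
      using that by (simp add: le_divide_eq_1_pos del: of_nat_Suc mult_Suc)
    thus ?thesis by (simp only: of_nat_le_iff)
  qed
  have "Suc n * 2 ^ n = (\<Sum>k\<le>n. Suc n * (n choose k))"
    by (simp only: choose_row_sum flip: sum_distrib_left)
  also have "\<dots> \<le> (\<Sum>k\<le>n. D)"
    using le by (intro sum_mono) auto
  also have "\<dots> = Suc n * D" by simp
  finally show ?thesis unfolding N by (simp only: Suc_mult_le_cancel1) simp
qed

text \<open>
  In the decomposition \<open>j = s * t\<^sup>2\<close> with \<open>s\<close> squarefree, \<open>s\<close> is a product of distinct primes up to \<open>N\<close>, and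
  \<open>t\<close> is at most the square root of \<open>N\<close>.
\<close>
lemma dvd_primorial_mult_fact_square:
  assumes "1 \<le> j" "j \<le> N"
  shows "j dvd primorial N * (fact (floor_sqrt N))\<^sup>2"
proof -
  define s t where "s = squarefree_part j" and "t = square_part j"
  have j: "j = s * t\<^sup>2" unfolding s_def t_def by (rule squarefree_decompose)
  have "s > 0" "t > 0" using assms j by (auto intro!: Nat.gr0I)
  have "s dvd primorial N"
  proof -
    have "s = (\<Prod>p\<in>prime_factors s. p)"
      using \<open>s > 0\<close> squarefree_factorial_semiring'[of s] prod_prime_factors[of s]
      using squarefree_squarefree_part[of j] s_def by (simp cong: prod.cong)
    moreover have "prime_factors s \<subseteq> {p. prime p \<and> p \<le> N}"
    proof safe
      fix p assume p: "p \<in> prime_factors s"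
      thus "prime p" by auto
      have "p dvd j" using p j by auto
      thus "p \<le> N" using assms by (auto dest: dvd_imp_le)
    qed
    ultimately show ?thesis
      unfolding primorial_def by (metis (no_types, lifting) finite_nat_set_iff_bounded_le
        mem_Collect_eq prod_dvd_prod_subset)
  qed
  moreover have "t \<le> floor_sqrt N"
  proof -
    have "t\<^sup>2 \<le> j" using j \<open>s > 0\<close> by simp
    thus ?thesis using assms by (intro le_floor_sqrtI) simp
  qed
  hence "t dvd fact (floor_sqrt N)" using \<open>t > 0\<close> by (intro dvd_fact) auto
  ultimately show ?thesis unfolding j by (intro mult_dvd_mono dvd_power_same)
qed

lemma primorial_lower_bound:
  assumes "N > 0"
  shows "2 ^ (N - 1) \<le> real (primorial N) * real N powr sqrt (real N)"
proof -
  define r where "r = floor_sqrt N"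
  have r: "r > 0" "r\<^sup>2 \<le> N" using assms by (auto simp: r_def)
  have "2 ^ (N - 1) \<le> primorial N * (fact r)\<^sup>2"
    unfolding r_def using assms primorial_pos[of N]
    by (intro common_multiple_ge dvd_primorial_mult_fact_square) auto
  also have "(fact r)\<^sup>2 \<le> (r ^ r)\<^sup>2"
    using fact_le_power[of r, where 'a=nat] by (intro power_mono) auto
  also have "(r ^ r)\<^sup>2 = (r\<^sup>2) ^ r" by (simp flip: power_mult add: mult.commute)
  also have "\<dots> \<le> N ^ r" using r by (intro power_mono) auto
  finally have "2 ^ (N - 1) \<le> primorial N * N ^ r" by simp
  hence "real (2 ^ (N - 1)) \<le> real (primorial N * N ^ r)" by (simp only: of_nat_le_iff)
  hence "2 ^ (N - 1) \<le> real (primorial N) * real N ^ r" by simp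
  also have "real N ^ r = real N powr real r"
    using assms by (simp add: powr_realpow)
  also have "\<dots> \<le> real N powr sqrt (real N)"
  proof (rule powr_mono)
    have "(real r)\<^sup>2 \<le> real N" using r(2) by (metis of_nat_le_iff of_nat_power)
    thus "real r \<le> sqrt (real N)" by (rule real_le_rsqrt)
  qed (use assms in auto)
  finally show ?thesis by (simp add: mult_left_mono)
qed

lemma eventually_primorial_ge: "eventually (\<lambda>m. sqrt 2 ^ m \<le> real (primorial m)) sequentially"
proof -
  have "eventually (\<lambda>m::nat. 2 powr (real m / 2) * real m powr sqrt (real m) \<le> 2 powr (real m - 1)) sequentially"
    by real_asymp
  thus ?thesis using eventually_gt_at_top[of 0]
  proof eventually_elim
    case (elim m)
    have "2 powr (real m - 1) = 2 ^ (m - 1)"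
      using elim by (simp add: of_nat_diff flip: powr_realpow)
    moreover have "sqrt 2 ^ m = 2 powr (real m / 2)"
      by (simp add: powr_half_sqrt[symmetric] powr_powr flip: powr_realpow)
    ultimately have "sqrt 2 ^ m * real m powr sqrt (real m) \<le> 2 ^ (m - 1)"
      using elim(1) by metis
    also have "\<dots> \<le> real (primorial m) * real m powr sqrt (real m)"
      using elim(2) by (rule primorial_lower_bound)
    finally have "sqrt 2 ^ m * real m powr sqrt (real m)
                    \<le> real (primorial m) * real m powr sqrt (real m)" .
    thus ?case using elim by simp
  qed
qed

lemma summable_inverse_primorial: "summable (\<lambda>m. 1 / real (primorial m))"
proof (rule summable_comparison_test_ev)
  show "eventually (\<lambda>m. norm (1 / real (primorial m)) \<le> (1 / sqrt 2) ^ m) sequentially"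
    using eventually_primorial_ge
  proof eventually_elim
    case (elim m)
    thus ?case using primorial_pos[of m] by (simp add: power_one_over field_simps)
  qed
qed (simp add: summable_geometric)

section \<open>The error term\<close>

text \<open>
  The error is the sum over \<open>m\<close> of the fractional parts of \<open>N / primorial m\<close>. The cutoff \<open>L\<close> is
  left free here: \<open>1\<close> bounds the parts below it, the growth of the primorial those above it.
\<close>
lemma abs_sum_least_nondiv_prime_le:
  assumes "\<And>m. m \<ge> L \<Longrightarrow> sqrt 2 ^ m \<le> real (primorial m)"
  shows "\<bar>(\<Sum>n=1..N. real (least_nondiv_prime n)) - real N * ell2\<bar>
           \<le> real L + real N * (1 / sqrt 2) ^ L / (1 - 1 / sqrt 2)"
proof -
  define e where "e = (\<lambda>m. real N * (1 / real (primorial m)) - real (N div primorial m))"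
  have e_eq: "e m = real (N mod primorial m) / real (primorial m)" for m
    unfolding e_def using primorial_pos[of m] 
    by (simp add: field_simps flip: of_nat_mult of_nat_add)
  have e0: "e m \<ge> 0" for m by (simp add: e_eq)
  have e1: "e m \<le> 1" for m using primorial_pos[of m] by (simp add: e_eq less_imp_le)
  have eN: "e m \<le> real N * (1 / sqrt 2) ^ m" if "m \<ge> L" for m
  proof -
    have "e m \<le> real N * (1 / real (primorial m))" by (simp add: e_def)
    also have "1 / real (primorial m) \<le> 1 / sqrt 2 ^ m"
      using assms[OF that] by (intro divide_left_mono) (auto simp: primorial_pos)
    finally show ?thesis by (simp add: power_one_over mult_left_mono)
  qed
  have sums: "e sums (real N * ell2 - (\<Sum>n=1..N. real (least_nondiv_prime n)))"
    unfolding e_def ell2_def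
    by (intro sums_diff sums_mult summable_sums summable_inverse_primorial sums_div_primorial)
  have geo: "(\<lambda>m. real N * (1 / sqrt 2) ^ (m + L)) sums
               (real N * (1 / sqrt 2) ^ L / (1 - 1 / sqrt 2))"
    using sums_mult[OF geometric_sums[of "1 / sqrt 2 :: real"], of "real N * (1 / sqrt 2) ^ L"]
    by (simp add: power_add mult_ac)
  have "suminf e = (\<Sum>m. e (m + L)) + (\<Sum>m<L. e m)"
    using sums by (intro suminf_split_initial_segment) (rule sums_summable)
  also have "(\<Sum>m<L. e m) \<le> (\<Sum>m<L. 1)" by (intro sum_mono e1)
  also have "(\<Sum>m. e (m + L)) \<le> (\<Sum>m. real N * (1 / sqrt 2) ^ (m + L))"
    using sums geo eN by (intro suminf_le) (auto simp: summable_iff_shift sums_iff)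
  also have "\<dots> = real N * (1 / sqrt 2) ^ L / (1 - 1 / sqrt 2)"
    using geo by (simp add: sums_iff)
  finally have "suminf e \<le> real L + real N * (1 / sqrt 2) ^ L / (1 - 1 / sqrt 2)" by simp
  moreover have "suminf e \<ge> 0" using sums e0 by (intro suminf_nonneg) (auto simp: sums_iff)
  ultimately show ?thesis using sums by (simp add: sums_iff)
qed

lemma mean_error_bigo:
  "(\<lambda>N. 1 / real N * (\<Sum>n = 1..N. real (least_nondiv_prime n)) - ell2)
     \<in> O[sequentially](\<lambda>N. ln (real N) / real N)"
proof -
  define c where "c = 1 / (1 - 1 / sqrt 2)"
  (* With this cutoff sqrt 2 ^ L N is at least N, so the geometric tail is bounded by c. *)
  define L where "L = (\<lambda>N. nat \<lceil>2 * log 2 (real N)\<rceil>)"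
  have "filterlim L at_top sequentially"
    unfolding L_def by real_asymp
  hence "eventually (\<lambda>N. \<forall>m\<ge>L N. sqrt 2 ^ m \<le> real (primorial m)) sequentially"
    using eventually_primorial_ge eventually_all_ge_at_top filterlim_iff by blast
  hence "eventually (\<lambda>N. norm (1 / real N * (\<Sum>n=1..N. real (least_nondiv_prime n)) - ell2)
           \<le> norm ((2 * log 2 (real N) + 1 + c) / real N)) sequentially"
    using eventually_gt_at_top[of 0]
  proof eventually_elim
    case (elim N)
    have log: "log 2 (real N) \<ge> 0" using elim by simp
    have "real N = 2 powr log 2 (real N)" using elim by simp
    also have "\<dots> = sqrt 2 powr (2 * log 2 (real N))"
      by (simp add: powr_half_sqrt[symmetric] powr_powr)
    also have "\<dots> \<le> sqrt 2 powr real (L N)"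
      by (intro powr_mono) (auto simp: L_def real_nat_ceiling_ge)
    also have "\<dots> = sqrt 2 ^ L N" by (simp add: powr_realpow)
    finally have "real N * (1 / sqrt 2) ^ L N \<le> 1" by (simp add: power_one_over)
    moreover have "c \<ge> 0" by (simp add: c_def)
    ultimately have "real N * (1 / sqrt 2) ^ L N * c \<le> 1 * c" by (intro mult_right_mono)
    moreover have "real (L N) \<le> 2 * log 2 (real N) + 1"
      unfolding L_def using log by linarith
    moreover have "\<bar>(\<Sum>n=1..N. real (least_nondiv_prime n)) - real N * ell2\<bar>
                     \<le> real (L N) + real N * (1 / sqrt 2) ^ L N * c"
      using abs_sum_least_nondiv_prime_le[of "L N" N] elim by (simp add: c_def)
    ultimately have "\<bar>(\<Sum>n=1..N. real (least_nondiv_prime n)) - real N * ell2\<bar>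
                       \<le> 2 * log 2 (real N) + 1 + c" by linarith
    hence "\<bar>(\<Sum>n=1..N. real (least_nondiv_prime n)) - real N * ell2\<bar> / real N
                       \<le> (2 * log 2 (real N) + 1 + c) / real N" by (rule divide_right_mono) simp
    also have "\<bar>(\<Sum>n=1..N. real (least_nondiv_prime n)) - real N * ell2\<bar> / real N
      = norm (1 / real N * (\<Sum>n=1..N. real (least_nondiv_prime n)) - ell2)"
    proof -
      have "1 / real N * S - ell2 = (S - real N * ell2) / real N" for S
        using elim by (simp add: field_simps)
      thus ?thesis by (simp add: abs_divide)
    qed
    finally show ?case using \<open>c \<ge> 0\<close> log by simp
  qed
  hence "(\<lambda>N. 1 / real N * (\<Sum>n = 1..N. real (least_nondiv_prime n)) - ell2)
     \<in> O[sequentially](\<lambda>N. (2 * log 2 (real N) + 1 + c) / real N)"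
    by (rule landau_o.big_mono)
  also have "(\<lambda>N. (2 * log 2 (real N) + 1 + c) / real N) \<in> O[sequentially](\<lambda>N. ln (real N) / real N)"
    by real_asymp
  finally show ?thesis .
qed

theorem corollary2:
  shows "summable (\<lambda>n. 1 / real (primorial n)) \<and>
    (\<lambda>N. 1 / real N * (\<Sum>n = 1..N. real (least_nondiv_prime n)) - ell2)
      \<in> O[sequentially](\<lambda>N. (ln (real N))\<^sup>2 / (real N * ln (ln (real N))))"
proof
  note mean_error_bigo
  also have "(\<lambda>N. ln (real N) / real N)
    \<in> O[sequentially](\<lambda>N. (ln (real N))\<^sup>2 / (real N * ln (ln (real N))))"
    by real_asymp
  finally show "(\<lambda>N. 1 / real N * (\<Sum>n = 1..N. real (least_nondiv_prime n)) - ell2)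
      \<in> O[sequentially](\<lambda>N. (ln (real N))\<^sup>2 / (real N * ln (ln (real N))))" .
qed (rule summable_inverse_primorial)

end
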